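(* For each integer $m>0$, there exists at most one ordered triple $(x,y,z)$ of positive integers with $x\le y\le z$, all three of which are Fibonacci numbers, satisfying $$x^2+y^2+z^2=3xyz+m,$$ except in the following cases: \begin{itemize} \item if $m=2$, the ordered Fibonacci solutions are exactly the triples $(1,F(b),F(b+2))$ for each even $b\ge 2$; \item if $m=21$, the ordered Fibonacci solutions are exactly $(1,2,8)$ and $(2,2,13)$, and both are minimal. \end{itemize} Moreover, there exist infinitely many integers $m>0$ for which there is exactly one such ordered Fibonacci solution, and that solution is minimal.
   Context: $F(n)$ denotes the $n$-th Fibonacci number, $F(0)=0$, $F(1)=1$, $F(n+1)=F(n)+F(n-1)$. A solution $(x,y,z)$ of $x^2+y^2+z^2=3xyz+m$ in positive integers with $x\le y\le z$ is called a Markoff $m$-triple; it is called minimal if $z\ge 3xy$. *)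

theory Defs
  imports "HOL-Number_Theory.Fib"
begin

definition markoff_triple :: "nat \<Rightarrow> nat \<times> nat \<times> nat \<Rightarrow> bool" where
  "markoff_triple m = (\<lambda>(x, y, z). 0 < x \<and> x \<le> y \<and> y \<le> z \<and>
     x\<^sup>2 + y\<^sup>2 + z\<^sup>2 = 3 * x * y * z + m)"

definition minimal_markoff_triple :: "nat \<Rightarrow> nat \<times> nat \<times> nat \<Rightarrow> bool" where
  "minimal_markoff_triple m = (\<lambda>(x, y, z). markoff_triple m (x, y, z) \<and> z \<ge> 3 * x * y)"

definition fibonacci_solutions :: "nat \<Rightarrow> (nat \<times> nat \<times> nat) set" where
  "fibonacci_solutions m =
     {(x, y, z). markoff_triple m (x, y, z) \<and> {x, y, z} \<subseteq> range fib}"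

end

(* Write x = F(a), y = F(b), z = F(c) with 2 <= a <= b <= c and m for x^2 + y^2 + z^2 - 3xyz.
   For c <= a + b the value m is at most 0, except for a = 2, c = b + 2 and b even, where Cassini's
   identity gives m = 2.  For c > a + b we have z >= 3xy, and for fixed c the value m is strictly
   decreasing in the product xy, so two triples with the same m and the same maximum agree.
   Moreover F(c-2)^2 - 4 <= m <= F(c)^2 - 3F(c) + 2, so equal values force maxima whose indices
   differ by at most one.  For maxima F(u) and F(u+1) the values interlace without meeting: as
   multiples of F(u)^2, the values with maximum F(u+1) cluster near 0.38, 0.44-0.46, 0.51, 0.91 or
   exceed 1, and those with maximum F(u) avoid these regions.  This is exact for u >= 13, and the
   finitely many smaller u contribute only (2,2,13) and (1,2,8). *)

theory Submission
  imports Defs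
begin

section \<open>Products of two Fibonacci numbers\<close>

abbreviation ifib :: "nat \<Rightarrow> int" where "ifib n \<equiv> int (fib n)"

text \<open>The addition formula with F(i-1) written as \<open>ifib (Suc i) - ifib i\<close>, which
  makes sense at \<open>i = 0\<close> as well.\<close>

lemma ifib_add: "ifib (n + i) = ifib i * ifib (Suc n) + (ifib (Suc i) - ifib i) * ifib n"
  by (induction i rule: fib.induct) (simp_all add: algebra_simps)

lemma ifib_Cassini: "(ifib (Suc n))\<^sup>2 - ifib (Suc n) * ifib n - (ifib n)\<^sup>2 = (-1) ^ n"
  using fib_Cassini_int[of n] by (simp add: algebra_simps power2_eq_square)

text \<open>Expanded in F(n+1) and F(n), the left side is F(i) F(j) times the quadratic form whose
  value Cassini's identity gives.\<close>

lemma ifib_Vajda: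
  "ifib (n + i) * ifib (n + j) - ifib n * ifib (n + (i + j)) = (-1) ^ n * (ifib i * ifib j)"
proof -
  have "ifib (Suc (i + j)) = ifib (Suc j) * ifib (Suc i) + ifib j * ifib i"
    using fib_add[of i j] by simp
  then have "ifib (n + i) * ifib (n + j) - ifib n * ifib (n + (i + j))
      = ifib i * ifib j * ((ifib (Suc n))\<^sup>2 - ifib (Suc n) * ifib n - (ifib n)\<^sup>2)"
    unfolding ifib_add[of n] ifib_add[of i j] by (simp add: algebra_simps power2_eq_square)
  then show ?thesis
    unfolding ifib_Cassini by simp
qed

lemma fib_strict_mono: "2 \<le> m \<Longrightarrow> m < n \<Longrightarrow> fib m < fib n"
proof -
  assume "2 \<le> m" "m < n"
  then obtain k where k: "m = Suc (Suc k)" by (metis add_2_eq_Suc le_Suc_ex)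
  have "fib m < fib (Suc m)" using fib_neq_0_nat[of "Suc k"] by (simp add: k)
  also have "\<dots> \<le> fib n" using \<open>m < n\<close> by (intro fib_mono) simp
  finally show ?thesis .
qed

lemma fib_pos: "2 \<le> n \<Longrightarrow> 1 \<le> fib n"
  using fib_neq_0_nat[of n] by simp

lemma fib_Suc_le_double: "1 \<le> n \<Longrightarrow> fib (Suc n) \<le> 2 * fib n"
  using fib_Suc_mono[of "n - 1"] by (cases n) simp_all

lemma fib_Suc_ge: "2 \<le> n \<Longrightarrow> 3 * fib n \<le> 2 * fib (Suc n)"
proof -
  assume "2 \<le> n"
  then obtain k where k: "n = Suc (Suc k)" by (metis add_2_eq_Suc le_Suc_ex)
  show ?thesis using fib_Suc_mono[of k] by (simp add: k)
qed

lemma fib_small: "fib 2 = 1" "fib 3 = 2" "fib 4 = 3" "fib 5 = 5" "fib 6 = 8"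
  by (simp_all add: eval_nat_numeral)

lemma rearrangement_nat:
  fixes p q r t :: nat
  assumes "r \<le> p" "t \<le> q"
  shows "p * t + r * q \<le> p * q + r * t"
proof -
  obtain d e where "p = r + d" "q = t + e" using assms by (metis le_iff_add)
  then show ?thesis by (simp add: algebra_simps)
qed

text \<open>Each bound below reduces to \<open>(F(k+1) - F(k)) (F(l+1) - F(l)) \<ge> 0\<close>.\<close>

lemma fib_mult_bounds:
  assumes "2 \<le> a" "2 \<le> b"
  shows "fib (a + b - 2) \<le> fib a * fib b" and "fib a * fib b \<le> 2 * fib (a + b - 3)"
proof -
  obtain k l where kl: "a = Suc (Suc k)" "b = Suc (Suc l)"
    using assms by (metis add_2_eq_Suc le_Suc_ex)
  have e: "a + b - 2 = Suc (Suc k + l)" "a + b - 3 = Suc (k + l)" by (simp_all add: kl)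
  have "fib k * fib (Suc l) + fib (Suc k) * fib l \<le> fib (Suc k) * fib (Suc l) + fib k * fib l"
    using rearrangement_nat[OF fib_Suc_mono[of k] fib_Suc_mono[of l]] by (simp add: algebra_simps)
  then show "fib (a + b - 2) \<le> fib a * fib b" "fib a * fib b \<le> 2 * fib (a + b - 3)"
    unfolding e fib_add by (simp_all add: kl algebra_simps)
qed

lemma fib_mult_ge_3:
  assumes "3 \<le> a" "3 \<le> b"
  shows "3 * fib (a + b - 4) \<le> fib a * fib b"
proof -
  obtain k l where kl: "a = k + 3" "b = l + 3"
    using assms by (metis add.commute le_Suc_ex)
  have e: "a + b - 4 = Suc (Suc k + l)" by (simp add: kl)
  have "fib k * fib (Suc l) + fib (Suc k) * fib l \<le> fib (Suc k) * fib (Suc l) + fib k * fib l"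
    using rearrangement_nat[OF fib_Suc_mono[of k] fib_Suc_mono[of l]] by (simp add: algebra_simps)
  then show ?thesis
    unfolding e fib_add by (simp add: kl eval_nat_numeral algebra_simps)
qed

lemma fib_mult_ge_8:
  assumes "5 \<le> a" "5 \<le> b"
  shows "8 * fib (a + b - 6) \<le> fib a * fib b"
proof -
  obtain k l where kl: "a = k + 5" "b = l + 5"
    using assms by (metis add.commute le_Suc_ex)
  have e: "a + b - 6 = Suc (Suc (Suc (Suc k)) + l)" by (simp add: kl)
  have "fib k * fib (Suc l) + fib (Suc k) * fib l \<le> fib (Suc k) * fib (Suc l) + fib k * fib l"
    using rearrangement_nat[OF fib_Suc_mono[of k] fib_Suc_mono[of l]] by (simp add: algebra_simps)
  then show ?thesis
    unfolding e fib_add by (simp add: kl eval_nat_numeral algebra_simps)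
qed

section \<open>Triples with \<open>c > a + b\<close>\<close>

text \<open>The number m in terms of the three indices; it is an integer because it can be negative,
  as for a = b = c = 3.\<close>

definition mval :: "nat \<Rightarrow> nat \<Rightarrow> nat \<Rightarrow> int" where
  "mval a b c = (ifib a)\<^sup>2 + (ifib b)\<^sup>2 + (ifib c)\<^sup>2 - 3 * ifib a * ifib b * ifib c"

text \<open>F(a+b+1) = F(a+1) F(b+1) + F(a) F(b), and two factors 3/2 make this at least (9/4 + 1)
  F(a) F(b). This is the source of minimality.\<close>

lemma fib_ge_3_mult:
  assumes "2 \<le> a" "2 \<le> b" "a + b < c"
  shows "3 * (fib a * fib b) \<le> fib c"
proof -
  have "(3 * fib a) * (3 * fib b) \<le> (2 * fib (Suc a)) * (2 * fib (Suc b))"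
    using assms by (intro mult_le_mono fib_Suc_ge) auto
  then have "3 * (fib a * fib b) \<le> fib (Suc (a + b))"
    by (simp add: fib_add algebra_simps)
  also have "\<dots> \<le> fib c" using assms by (intro fib_mono) simp
  finally show ?thesis .
qed

text \<open>The difference of the two sides factors as (x-x')(x+x'-3y'z) + (y-y')(y+y'-3xz). Both
  second factors are negative, and one of the first factors is positive.\<close>

lemma sum_squares_strict_antimono:
  fixes x y x' y' z :: int
  assumes "0 < x" "0 < y'" "x' \<le> x" "y' \<le> y" "x < z" "y < z" "x' * y' < x * y"
  shows "x\<^sup>2 + y\<^sup>2 - 3 * x * y * z < x'\<^sup>2 + y'\<^sup>2 - 3 * x' * y' * z"
proof -
  have z: "1 * z \<le> y' * z" "1 * z \<le> x * z"
    using assms by (intro mult_right_mono; simp)+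
  have neg: "x + x' - 3 * (y' * z) < 0" "y + y' - 3 * (x * z) < 0"
    using assms z by linarith+
  have "x' < x \<or> y' < y" using assms by force
  then have "(x - x') * (x + x' - 3 * (y' * z)) + (y - y') * (y + y' - 3 * (x * z)) < 0"
    using neg assms by (elim disjE; intro add_neg_nonpos add_nonpos_neg mult_pos_neg mult_nonneg_nonpos) linarith+
  then show ?thesis by (simp add: algebra_simps power2_eq_square)
qed

text \<open>A pair that spreads more widely, with at least as large a product, exceeds the inner
  product by a definite amount. In the comparison of values this excess, multiplied by 3z, has to
  outweigh the larger square F(b)^2.\<close>

lemma fib_mult_gap:
  assumes "2 \<le> a" "a < a'" "a' \<le> b'" "b' < b" "fib a' * fib b' \<le> fib a * fib b"
  shows "fib b \<le> 9 * fib a * (fib a * fib b - fib a' * fib b')"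
proof -
  have pos: "1 \<le> fib a" using assms fib_pos by simp
  have le1: "fib (a' + b' - 2) \<le> fib a' * fib b'" and le2: "fib a' * fib b' \<le> 2 * fib (a' + b' - 3)"
    using assms fib_mult_bounds[of a' b'] by auto
  have le3: "fib (a + b - 2) \<le> fib a * fib b" and le4: "fib a * fib b \<le> 2 * fib (a + b - 3)"
    using assms fib_mult_bounds[of a b] by auto
  consider "a + b < a' + b'" | "a + b = a' + b'" | "a' + b' < a + b" by linarith
  then show ?thesis
  proof cases
    \<comment> \<open>Impossible: F(a) F(b) \<le> 2 F(a+b-3) < F(a+b-1) \<le> F(a') F(b').\<close>
    case 1
    define k where "k = a + b - 5"
    have k: "a + b = k + 5" using assms by (simp add: k_def)
    have "2 * fib (a + b - 3) < fib (a + b - 1)"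
      using fib_neq_0_nat[of "Suc k"] by (simp add: k eval_nat_numeral)
    also have "\<dots> \<le> fib (a' + b' - 2)" using 1 by (intro fib_mono) simp
    finally show ?thesis using le1 le4 assms by linarith
  next
    \<comment> \<open>With equal index sums Vajda's identity gives the excess exactly: it is F(i)
      F(j), and \<open>a\<close> must be odd.\<close>
    case 2
    define i j where "i = a' - a" and "j = b' - a"
    have ij: "1 \<le> i" "1 \<le> j" "a' = a + i" "b' = a + j" "b = a + (i + j)"
      using assms 2 by (auto simp: i_def j_def)
    have pos': "0 < ifib i * ifib j" using ij by (simp add: fib_neq_0_nat)
    have le: "ifib a' * ifib b' \<le> ifib a * ifib b"
      using assms(5) by (metis of_nat_le_iff of_nat_mult)
    have V: "ifib a' * ifib b' - ifib a * ifib b = (-1) ^ a * (ifib i * ifib j)"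
      unfolding ij by (rule ifib_Vajda)
    have "odd a" using V le pos' by (cases "even a") auto
    then have "ifib a * ifib b = ifib a' * ifib b' + ifib i * ifib j"
      using V by simp
    then have D: "fib a * fib b - fib a' * fib b' = fib i * fib j"
      by (metis add_diff_cancel_left' of_nat_add of_nat_eq_iff of_nat_mult)
    have "fib (Suc i) * fib (Suc (Suc j)) \<le> (2 * fib i) * (3 * fib j)"
      using ij fib_Suc_le_double[of i] fib_Suc_le_double[of j] by (intro mult_le_mono) auto
    moreover have "fib i * fib (Suc j) \<le> fib i * (2 * fib j)"
      using ij fib_Suc_le_double[of j] by (intro mult_le_mono) auto
    moreover have "fib (Suc (Suc (i + j))) = fib (Suc i) * fib (Suc (Suc j)) + fib i * fib (Suc j)"
      using fib_add[of i "Suc j"] by (simp add: algebra_simps)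
    ultimately have le9: "fib (Suc (Suc (i + j))) \<le> 9 * (fib i * fib j)" by linarith
    define k where "k = a - 1"
    have k: "a = Suc k" using assms by (simp add: k_def)
    have "fib b = fib (Suc k) * fib (Suc (i + j)) + fib k * fib (i + j)"
      using fib_add[of k "i + j"] by (simp add: ij k algebra_simps)
    also have "\<dots> \<le> fib a * fib (Suc (i + j)) + fib a * fib (i + j)"
      using fib_Suc_mono[of k] by (simp add: k)
    also have "\<dots> = fib a * fib (Suc (Suc (i + j)))" by (simp add: algebra_simps)
    also have "\<dots> \<le> fib a * (9 * (fib i * fib j))" using le9 by (rule mult_le_mono2)
    finally show ?thesis by (simp add: D algebra_simps)
  next
    \<comment> \<open>Here the inner product is at most 8/9 of the outer one, so the excess is at
      least a ninth of F(a) F(b).\<close>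
    case 3
    define k where "k = a + b - 6"
    have k: "a + b = k + 6" using assms by (simp add: k_def)
    have "9 * (2 * fib (k + 2)) \<le> 8 * fib (k + 4)"
      using fib_Suc_mono[of k] by (simp add: eval_nat_numeral)
    moreover have "fib (a' + b' - 3) \<le> fib (k + 2)" using 3 k by (intro fib_mono) simp
    moreover have "fib (k + 4) \<le> fib a * fib b" using le3 by (simp add: k add.commute)
    ultimately have "fib a * fib b \<le> 9 * (fib a * fib b - fib a' * fib b')"
      using le2 by linarith
    from mult_le_mono[OF pos this] have "1 * (fib a * fib b) \<le> fib a * (9 * (fib a * fib b - fib a' * fib b'))" .
    moreover have "1 * fib b \<le> fib a * fib b" using pos by (rule mult_le_mono1)
    moreover have "9 * fib a * (fib a * fib b - fib a' * fib b')
        = fib a * (9 * (fib a * fib b - fib a' * fib b'))" by simp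
    ultimately show ?thesis by linarith
  qed
qed

text \<open>For nested pairs (one strictly inside the other) the gap bound with equal products would
  give F(b) \<le> 0; otherwise the pairs are comparable componentwise and strict monotonicity
  applies.\<close>

lemma fib_mult_inj:
  assumes "2 \<le> a" "a \<le> b" "2 \<le> a'" "a' \<le> b'" "fib a * fib b = fib a' * fib b'"
  shows "a = a' \<and> b = b'"
proof -
  have mono: False
    if "2 \<le> a" "2 \<le> b" "a \<le> a'" "b \<le> b'" "a \<noteq> a' \<or> b \<noteq> b'" "fib a * fib b = fib a' * fib b'" for a b a' b'
  proof -
    have "fib a * fib b < fib a' * fib b'"
      using that fib_pos[of a] fib_pos[of b] fib_mono[of a a'] fib_mono[of b b']
        fib_strict_mono[of a a'] fib_strict_mono[of b b']
      by (metis (full_types) le_neq_implies_less less_le_trans mult_le_less_imp_less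
          mult_less_le_imp_less not_one_le_zero zero_less_iff_neq_zero le0 zero_less_one)
    then show False using that by simp
  qed
  have gap: False if "2 \<le> a" "a < a'" "a' \<le> b'" "b' < b" "fib a * fib b = fib a' * fib b'" for a b a' b'
    using fib_mult_gap[of a a' b' b] fib_pos[of b] that by simp
  consider "a < a'" "b' < b" | "a' < a" "b < b'" | "a \<le> a'" "b \<le> b'" | "a' \<le> a" "b' \<le> b"
    by linarith
  then show ?thesis
  proof cases
    case 1
    then show ?thesis using gap[of a a' b' b] assms by simp
  next
    case 2
    then show ?thesis using gap[of a' a b b'] assms by simp
  next
    case 3
    then show ?thesis using mono[of a b a' b'] assms by force
  next
    case 4
    then show ?thesis using mono[of a' b' a b] assms by force
  qed
qed

text \<open>The term 3xyz dominates the squares of the two smaller entries. The proof compares the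
  index pairs componentwise; only the case \<open>a < a'\<close>, \<open>b' < b\<close> needs the
  quantitative gap.\<close>

lemma mval_strict_antimono:
  assumes ab: "2 \<le> a" "a \<le> b" "a + b < c" and ab': "2 \<le> a'" "a' \<le> b'" "a' + b' < c"
    and less: "fib a' * fib b' < fib a * fib b"
  shows "mval a b c < mval a' b' c"
proof -
  define x y x' y' z where defs: "x = ifib a" "y = ifib b" "x' = ifib a'" "y' = ifib b'" "z = ifib c"
  have pos: "0 < x" "0 < y" "0 < x'" "0 < y'"
    using ab ab' by (auto simp: defs fib_neq_0_nat)
  have zx: "x < z" "y < z" "x \<le> y" "x' \<le> y'"
    using ab ab' by (auto simp: defs intro!: fib_strict_mono fib_mono)
  have lt: "x' * y' < x * y" using less by (metis defs of_nat_less_iff of_nat_mult)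
  have z3: "3 * (x * y) \<le> z"
    using of_nat_mono[OF fib_ge_3_mult[of a b c], where 'a = int] ab by (simp add: defs)
  consider "a' \<le> a" "b' \<le> b" | "a < a'" "b' < b" | "a' < a" "b < b'" | "a \<le> a'" "b \<le> b'"
    by linarith
  then have "x\<^sup>2 + y\<^sup>2 - 3 * x * y * z < x'\<^sup>2 + y'\<^sup>2 - 3 * x' * y' * z"
  proof cases
    case 1
    then have "x' \<le> x" "y' \<le> y" by (simp_all add: defs fib_mono)
    then show ?thesis using pos zx lt by (intro sum_squares_strict_antimono)
  next
    case 2
    have "fib b \<le> 9 * fib a * (fib a * fib b - fib a' * fib b')"
      using 2 ab ab' less by (intro fib_mult_gap) auto
    then have "int (fib b) \<le> int (9 * fib a * (fib a * fib b - fib a' * fib b'))"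
      by (rule of_nat_mono)
    then have g: "y \<le> 9 * x * (x * y - x' * y')"
      using less by (simp add: defs of_nat_diff)
    \<comment> \<open>The gap bound and 3xy \<le> z combine to y^2 \<le> 3z (xy - x'y').\<close>
    have "y * y \<le> y * (9 * x * (x * y - x' * y'))"
      using g pos by (intro mult_left_mono) auto
    also have "\<dots> = 3 * ((3 * (x * y)) * (x * y - x' * y'))" by (simp add: algebra_simps)
    also have "\<dots> \<le> 3 * (z * (x * y - x' * y'))"
      using z3 lt by (intro mult_left_mono mult_right_mono) auto
    finally have "y\<^sup>2 \<le> 3 * x * y * z - 3 * x' * y' * z" by (simp add: algebra_simps power2_eq_square)
    moreover have "x\<^sup>2 \<le> x'\<^sup>2" "0 < y'\<^sup>2"
      using 2 pos by (auto simp: defs fib_mono intro!: power_mono)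
    ultimately show ?thesis by linarith
  next
    case 3
    \<comment> \<open>Growth by 3/2 from \<open>b\<close> to \<open>b'\<close> gives x^2 + y^2 \<le>
      2y^2 \<le> (8/9) y'^2, so the squares alone decide.\<close>
    have "3 * fib b \<le> 2 * fib (Suc b)" using ab by (intro fib_Suc_ge) simp
    moreover have "fib (Suc b) \<le> fib b'" using 3 by (intro fib_mono) simp
    ultimately have "3 * y \<le> 2 * y'" unfolding defs by linarith
    then have "(3 * y)\<^sup>2 \<le> (2 * y')\<^sup>2" using pos by (intro power_mono) auto
    then have "9 * y\<^sup>2 \<le> 4 * y'\<^sup>2" by (simp add: power_mult_distrib)
    moreover have "x\<^sup>2 \<le> y\<^sup>2" using pos zx by (intro power_mono) auto
    moreover have "0 < y'\<^sup>2" "0 < x'\<^sup>2" using pos by auto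
    moreover have "z * (x' * y') \<le> z * (x * y)" using lt pos zx by (intro mult_left_mono) auto
    moreover have "3 * x * y * z = 3 * (z * (x * y))" "3 * x' * y' * z = 3 * (z * (x' * y'))" by simp_all
    ultimately show ?thesis by linarith
  next
    case 4
    then have "x * y \<le> x' * y'" using pos by (intro mult_mono) (auto simp: defs fib_mono)
    then show ?thesis using lt by simp
  qed
  then show ?thesis by (simp add: mval_def defs)
qed

lemma mval_antimono:
  assumes "2 \<le> a" "a \<le> b" "a + b < c" "2 \<le> a'" "a' \<le> b'" "a' + b' < c"
    and "fib a' * fib b' \<le> fib a * fib b"
  shows "mval a b c \<le> mval a' b' c"
proof (cases "fib a' * fib b' = fib a * fib b")
  case True
  have "a' = a \<and> b' = b" using assms True by (intro fib_mult_inj)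
  then show ?thesis by simp
next
  case False
  then have "fib a' * fib b' < fib a * fib b" using assms by linarith
  then show ?thesis using assms by (intro less_imp_le[OF mval_strict_antimono])
qed

lemma mval_inj_same_max:
  assumes "2 \<le> a" "a \<le> b" "a + b < c" "2 \<le> a'" "a' \<le> b'" "a' + b' < c"
    and "mval a b c = mval a' b' c"
  shows "a = a' \<and> b = b'"
proof (rule fib_mult_inj)
  show "fib a * fib b = fib a' * fib b'"
    using mval_strict_antimono[of a b c a' b'] mval_strict_antimono[of a' b' c a b] assms
    by (cases "fib a * fib b" "fib a' * fib b'" rule: linorder_cases) simp_all
qed (use assms in auto)

section \<open>Bounds for the value in terms of the maximum\<close>

lemma mval_le:
  assumes "2 \<le> a" "a \<le> b" "a + b < c"
  shows "mval a b c \<le> (ifib c)\<^sup>2 - 3 * ifib c + 2"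
proof -
  have "mval a b c \<le> mval 2 2 c"
    using assms fib_pos[of a] fib_pos[of b] by (intro mval_antimono) auto
  then show ?thesis by (simp add: mval_def)
qed

lemma mval_ge:
  assumes "fib a * fib b \<le> P"
  shows "(ifib c)\<^sup>2 - 3 * int P * ifib c \<le> mval a b c"
proof -
  have "ifib a * ifib b \<le> int P" using assms by (metis of_nat_le_iff of_nat_mult)
  then have "ifib a * ifib b * (3 * ifib c) \<le> int P * (3 * ifib c)"
    by (intro mult_right_mono) auto
  moreover have "0 \<le> (ifib a)\<^sup>2" "0 \<le> (ifib b)\<^sup>2" by auto
  moreover have "3 * ifib a * ifib b * ifib c = ifib a * ifib b * (3 * ifib c)"
    "3 * int P * ifib c = int P * (3 * ifib c)" by simp_all
  ultimately show ?thesis unfolding mval_def by linarith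
qed

text \<open>By Cassini's identity the value equals F(n+2)^2 + 4 + 8 (-1)^n.\<close>

lemma mval_3_ge: "(ifib (n + 2))\<^sup>2 - 4 \<le> mval 3 n (n + 4)"
proof -
  have "mval 3 n (n + 4) = (ifib (n + 2))\<^sup>2 + 4 + 8 * ((ifib (Suc n))\<^sup>2 - ifib (Suc n) * ifib n - (ifib n)\<^sup>2)"
    by (simp add: mval_def eval_nat_numeral) (simp add: algebra_simps)
  also have "\<dots> = (ifib (n + 2))\<^sup>2 + 4 + 8 * (-1) ^ n"
    unfolding ifib_Cassini by simp
  finally show ?thesis by (cases "even n") auto
qed

text \<open>Since F(a) F(b) \<le> 2 F(c-4) = F(3) F(c-4), the triple with indices 3, c-4, c is a
  lower comparison. It needs c-4 \<ge> 3 to be ordered, so c = 5 and c = 6 are computed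
  directly.\<close>

lemma mval_lower:
  assumes "2 \<le> a" "a \<le> b" "a + b < c"
  shows "(ifib (c - 2))\<^sup>2 - 4 \<le> mval a b c"
proof -
  define n where "n = c - 4"
  have n: "c = n + 4" using assms by (simp add: n_def)
  have "n = 1 \<or> n = 2 \<or> 3 \<le> n" using assms n by linarith
  then show ?thesis
  proof (elim disjE)
    assume "n = 1"
    then have "a = 2" "b = 2" using assms n by auto
    then show ?thesis using \<open>n = 1\<close> n by (simp add: mval_def eval_nat_numeral)
  next
    assume "n = 2"
    then have "a = 2" "b = 2 \<or> b = 3" using assms n by auto
    then show ?thesis using \<open>n = 2\<close> n by (auto simp add: mval_def eval_nat_numeral)
  next
    assume "3 \<le> n"
    have "fib a * fib b \<le> 2 * fib (a + b - 3)" using assms fib_mult_bounds by auto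
    also have "\<dots> \<le> fib 3 * fib n"
      using assms n fib_mono[of "a + b - 3" n] by (auto simp: fib_small)
    finally have "mval 3 n c \<le> mval a b c"
      using \<open>3 \<le> n\<close> n assms by (intro mval_antimono) auto
    then show ?thesis using mval_3_ge[of n] n by simp
  qed
qed

text \<open>The upper bound F(c')^2 - 3F(c') + 2 lies below F(c')^2 - 4 because F(c') \<ge> 5, and
  c' \<le> c - 2 makes the lower bound for \<open>c\<close> at least the latter.\<close>

lemma mval_less_of_gap2:
  assumes "2 \<le> a" "a \<le> b" "a + b < c" "2 \<le> a'" "a' \<le> b'" "a' + b' < c'" "c' + 2 \<le> c"
  shows "mval a' b' c' < mval a b c"
proof -
  have "fib 5 \<le> fib c'" using assms by (intro fib_mono) simp
  then have c': "5 \<le> ifib c'" by (simp add: eval_nat_numeral)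
  have "(ifib c')\<^sup>2 \<le> (ifib (c - 2))\<^sup>2"
    using assms by (intro power_mono) (auto intro!: fib_mono)
  then show ?thesis
    using mval_lower[of a b c] mval_le[of a' b' c'] assms c' by linarith
qed

section \<open>Triples with consecutive maxima\<close>

text \<open>With \<open>t = F(v + 1)\<close> and \<open>r = F(v)\<close>, the difference of the two sides of each
  inequality below is a quadratic form \<open>A t\<^sup>2 + B t r + C r\<^sup>2 + K\<close> with \<open>A, B, C > 0\<close> and
  \<open>A + K > 0\<close>. The index shift 13 is the least that works for all of them.\<close>

lemma pos_quadratic:
  fixes t r A B C K :: int
  assumes "1 \<le> t" "0 \<le> r" "0 \<le> A" "0 \<le> B" "0 \<le> C" "0 < A + K"
  shows "0 < A * (t * t) + B * (t * r) + C * (r * r) + K"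
proof -
  have "A * 1 \<le> A * (t * t)" using assms mult_mono[of 1 t 1 t] by (intro mult_left_mono) auto
  moreover have "0 \<le> B * (t * r)" "0 \<le> C * (r * r)" using assms by auto
  ultimately show ?thesis using assms by linarith
qed

lemma ifib_shift:
  shows "ifib (v + 4) = 3 * ifib (Suc v) + 2 * ifib v"
    and "ifib (v + 6) = 8 * ifib (Suc v) + 5 * ifib v"
    and "ifib (v + 7) = 13 * ifib (Suc v) + 8 * ifib v"
    and "ifib (v + 8) = 21 * ifib (Suc v) + 13 * ifib v"
    and "ifib (v + 9) = 34 * ifib (Suc v) + 21 * ifib v"
    and "ifib (v + 10) = 55 * ifib (Suc v) + 34 * ifib v"
    and "ifib (v + 11) = 89 * ifib (Suc v) + 55 * ifib v"
    and "ifib (v + 13) = 233 * ifib (Suc v) + 144 * ifib v"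
    and "ifib (v + 14) = 377 * ifib (Suc v) + 233 * ifib v"
  by (simp_all add: eval_nat_numeral)

lemma
  shows consecutive_max_0: "(ifib (v + 13))\<^sup>2 < (ifib (v + 14))\<^sup>2 - 3 * int (2 * fib (v + 9)) * ifib (v + 14)" (is ?A)
    and consecutive_max_2_less: "mval 2 (v + 6) (v + 13) < mval 2 (v + 11) (v + 14)" (is ?B)
    and consecutive_max_2_greater: "mval 2 (v + 11) (v + 14) < (ifib (v + 13))\<^sup>2 - 3 * int (2 * fib (v + 4)) * ifib (v + 13)" (is ?C)
    and consecutive_max_3_less: "mval 2 (v + 10) (v + 13) < mval 3 (v + 10) (v + 14)" (is ?D)
    and consecutive_max_3_greater: "mval 3 (v + 10) (v + 14) < mval 3 (v + 8) (v + 13)" (is ?E)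
    and consecutive_max_6_greater: "mval 6 (v + 7) (v + 14) < mval 3 (v + 8) (v + 13)" (is ?F)
    and consecutive_max_4_less: "mval 4 (v + 7) (v + 13) < mval 4 (v + 9) (v + 14)" (is ?G)
    and consecutive_max_4_greater: "mval 4 (v + 9) (v + 14) < mval 2 (v + 9) (v + 13)" (is ?H)
    and consecutive_max_4_greater': "mval 4 (v + 9) (v + 14) < (ifib (v + 13))\<^sup>2 - 3 * int (2 * fib (v + 7)) * ifib (v + 13)" (is ?I)
proof -
  define t r where tr: "t = ifib (Suc v)" "r = ifib v"
  have "1 \<le> t" "0 \<le> r" using fib_neq_0_nat[of "Suc v"] unfolding tr by linarith+
  note pos = pos_quadratic[OF this]
  note expand = mval_def ifib_shift[of v, folded tr] of_nat_mult of_nat_numeral fib_small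
    power2_eq_square
  show ?A
    using pos[of 10932 13544 4195 "0"] unfolding expand by (simp add: algebra_simps)
  show ?B
    using pos[of 630 823 268 "0"] unfolding expand by (simp add: algebra_simps)
  show ?C
    using pos[of 704 660 139 "-1"] unfolding expand by (simp add: algebra_simps)
  show ?D
    using pos[of 1875 2306 709 "3"] unfolding expand by (simp add: algebra_simps)
  show ?E
    using pos[of 4628 5708 1760 "0"] unfolding expand by (simp add: algebra_simps)
  show ?F
    using pos[of 698 522 56 "-60"] unfolding expand by (simp add: algebra_simps)
  show ?G
    using pos[of 726 871 261 "0"] unfolding expand by (simp add: algebra_simps)
  show ?H
    using pos[of 3756 4606 1412 "-8"] unfolding expand by (simp add: algebra_simps)
  show ?I
    using pos[of 8192 10129 3131 "-9"] unfolding expand by (simp add: algebra_simps)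
qed

text \<open>Each value is trapped between those of explicit comparison pairs with the same maximum,
  and the inequalities \<open>consecutive_max_*\<close> separate the resulting ranges.\<close>

lemma mval_consecutive_neq:
  assumes ab: "2 \<le> a" "a \<le> b" "a + b < v + 14"
    and ab': "2 \<le> a'" "a' \<le> b'" "a' + b' < v + 13"
  shows "mval a b (v + 14) \<noteq> mval a' b' (v + 13)"
proof -
  define m m' where "m = mval a b (v + 14)" and "m' = mval a' b' (v + 13)"
  \<comment> \<open>Antimonotonicity in the product: a comparison pair with smaller product bounds
    the value from above (\<open>up\<close>, \<open>up'\<close>), one with larger product from below
    (\<open>down\<close>, \<open>down'\<close>).\<close>
  have up: "m \<le> mval i j (v + 14)"
    if "2 \<le> i" "i \<le> j" "i + j < v + 14" "fib i * fib j \<le> fib a * fib b" for i j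
    unfolding m_def using ab that by (rule mval_antimono)
  have down: "mval i j (v + 14) \<le> m"
    if "2 \<le> i" "i \<le> j" "i + j < v + 14" "fib a * fib b \<le> fib i * fib j" for i j
    unfolding m_def using that(1-3) ab that(4) by (rule mval_antimono)
  have up': "m' \<le> mval i j (v + 13)"
    if "2 \<le> i" "i \<le> j" "i + j < v + 13" "fib i * fib j \<le> fib a' * fib b'" for i j
    unfolding m'_def using ab' that by (rule mval_antimono)
  have down': "mval i j (v + 13) \<le> m'"
    if "2 \<le> i" "i \<le> j" "i + j < v + 13" "fib a' * fib b' \<le> fib i * fib j" for i j
    unfolding m'_def using that(1-3) ab' that(4) by (rule mval_antimono)
  have prod_le: "fib a * fib b \<le> 2 * fib k" if "a + b \<le> k + 3" for k
  proof -
    have "fib (a + b - 3) \<le> fib k" using that by (intro fib_mono) simp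
    then show ?thesis using fib_mult_bounds(2)[of a b] ab by linarith
  qed
  have prod_le': "fib a' * fib b' \<le> 2 * fib k" if "a' + b' \<le> k + 3" for k
  proof -
    have "fib (a' + b' - 3) \<le> fib k" using that by (intro fib_mono) simp
    then show ?thesis using fib_mult_bounds(2)[of a' b'] ab' by linarith
  qed
  have prod_ge': "fib 2 * fib k \<le> fib a' * fib b'" if "k + 2 \<le> a' + b'" for k
  proof -
    have "fib k \<le> fib (a' + b' - 2)" using that by (intro fib_mono) simp
    then show ?thesis using fib_mult_bounds(1)[of a' b'] ab' by simp
  qed
  have m_ge: "(ifib (v + 14))\<^sup>2 - 3 * int (2 * fib k) * ifib (v + 14) \<le> m" if "a + b \<le> k + 3" for k
    unfolding m_def using prod_le[OF that] by (rule mval_ge)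
  have m'_ge: "(ifib (v + 13))\<^sup>2 - 3 * int (2 * fib k) * ifib (v + 13) \<le> m'" if "a' + b' \<le> k + 3" for k
    unfolding m'_def using prod_le'[OF that] by (rule mval_ge)
  consider (small) "a + b \<le> v + 12" | (two) "a = 2" "b = v + 11" | (ge3) "3 \<le> a" "a + b = v + 13"
    using ab by linarith
  then have "m \<noteq> m'"
  proof cases
    \<comment> \<open>The product is at most 2 F(v+9), which already lifts m above F(v+13)^2, hence
      above every m'.\<close>
    case small
    have "fib 3 \<le> fib (v + 13)" by (intro fib_mono) simp
    then have "m' < (ifib (v + 13))\<^sup>2"
      using mval_le[OF ab'] unfolding m'_def fib_small by linarith
    then show ?thesis using m_ge[of "v + 9"] small consecutive_max_0[of v] by simp
  next
    case two
    show ?thesis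
    \<comment> \<open>Index sums of at least v+8 put m' below m, smaller sums put it above.\<close>
    proof (cases "v + 8 \<le> a' + b'")
      case True
      then have "m' \<le> mval 2 (v + 6) (v + 13)" by (intro up' prod_ge') auto
      then show ?thesis using consecutive_max_2_less[of v] two by (simp add: m_def)
    next
      case False
      then show ?thesis using m'_ge[of "v + 4"] consecutive_max_2_greater[of v] two by (simp add: m_def)
    qed
  next
    case ge3
    \<comment> \<open>With a + b = v + 13 the pair (3, v+10) has the largest admissible product
      bound, 2 F(v+10). Values m' with a' + b' = v + 12 fall below it.\<close>
    have lower: "mval 3 (v + 10) (v + 14) \<le> m"
      using prod_le[of "v + 10"] ge3 by (intro down) (auto simp: fib_small)
    show ?thesis
    proof (cases "a' + b' \<le> v + 11")
      case False
      then have "m' \<le> mval 2 (v + 10) (v + 13)" using ab' by (intro up' prod_ge') auto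
      then show ?thesis using consecutive_max_3_less[of v] lower by simp
    next
      case True
      then have lower': "mval 3 (v + 8) (v + 13) \<le> m'"
        using prod_le'[of "v + 8"] by (intro down') (auto simp: fib_small)
      consider "a = 3" | "a = 4" | "5 \<le> a" using ge3 by linarith
      then show ?thesis
      proof cases
        case 1
        then have "b = v + 10" using ge3 by simp
        then show ?thesis using consecutive_max_3_greater[of v] lower' 1 by (simp add: m_def)
      next
        case 2
        \<comment> \<open>Only for a = 4 does \<open>lower'\<close> not suffice: m' then falls on
          either side of m, according to the index sum and to whether a' = 2.\<close>
        then have b: "b = v + 9" using ge3 by simp
        consider "a' + b' \<le> v + 10" | "a' = 2" "b' = v + 9" | "3 \<le> a'" "a' + b' = v + 11"
          using True ab' by linarith
        then show ?thesis
        proof cases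
          case 1
          then show ?thesis
            using m'_ge[of "v + 7"] consecutive_max_4_greater'[of v] \<open>a = 4\<close> b by (simp add: m_def)
        next
          case 2
          then show ?thesis
            using consecutive_max_4_greater[of v] \<open>a = 4\<close> b by (simp add: m_def m'_def)
        next
          case 3
          have "m' \<le> mval 4 (v + 7) (v + 13)"
            using 3 fib_mult_ge_3[of a' b'] ab' by (intro up') (auto simp: fib_small add.commute)
          then show ?thesis using consecutive_max_4_less[of v] \<open>a = 4\<close> b by (simp add: m_def)
        qed
      next
        case 3
        \<comment> \<open>The product is at least 8 F(v+7) = F(6) F(v+7).\<close>
        have "m \<le> mval 6 (v + 7) (v + 14)"
          using 3 fib_mult_ge_8[of a b] ab ge3 by (intro up) (auto simp: fib_small add.commute)
        then show ?thesis using consecutive_max_6_greater[of v] lower' by simp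
      qed
    qed
  qed
  then show ?thesis by (simp add: m_def m'_def)
qed

text \<open>Finite check for c' = u and c = u + 1 with u at most 12; the upper ends of the ranges of
  \<open>b\<close> and \<open>b'\<close> encode a + b < c and a' + b' < c'. The single collision has
  value 21.\<close>

lemma consecutive_small:
  "\<forall>u\<in>set [4..<13]. \<forall>a\<in>set [2..<u]. \<forall>b\<in>set [a..<Suc u - a]. \<forall>a'\<in>set [2..<u]. \<forall>b'\<in>set [a'..<u - a'].
     mval a b (Suc u) = mval a' b' u \<longrightarrow> u = 6 \<and> a = 3 \<and> b = 3 \<and> a' = 2 \<and> b' = 3"
  by code_simp

lemma mval_eq_consecutive:
  assumes "2 \<le> a" "a \<le> b" "a + b < c" "2 \<le> a'" "a' \<le> b'" "a' + b' < c'" "c' < c"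
    and eq: "mval a b c = mval a' b' c'"
  shows "a = 3 \<and> b = 3 \<and> c = 7 \<and> a' = 2 \<and> b' = 3 \<and> c' = 6"
proof -
  have c: "c = Suc c'"
    using mval_less_of_gap2[of a b c a' b' c'] assms by linarith
  show ?thesis
  proof (cases "13 \<le> c'")
    case True
    then obtain v where "c' = v + 13" by (metis add.commute le_Suc_ex)
    then show ?thesis using mval_consecutive_neq[of a b v a' b'] assms c by (simp add: add.commute)
  next
    case False
    then have "c' \<in> set [4..<13]" "a \<in> set [2..<c']" "b \<in> set [a..<Suc c' - a]"
      "a' \<in> set [2..<c']" "b' \<in> set [a'..<c' - a']"
      using assms c by auto
    then have "mval a b (Suc c') = mval a' b' c' \<longrightarrow> c' = 6 \<and> a = 3 \<and> b = 3 \<and> a' = 2 \<and> b' = 3"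
      by (intro consecutive_small[THEN bspec, THEN bspec, THEN bspec, THEN bspec, THEN bspec])
    then show ?thesis using eq c by simp
  qed
qed

section \<open>Fibonacci solutions\<close>

lemma mval_2_add_2:
  assumes "2 \<le> b"
  shows "mval 2 b (b + 2) = 1 + (-1) ^ b"
proof -
  obtain k where k: "b = Suc (Suc k)" using assms by (metis add_2_eq_Suc le_Suc_ex)
  have "mval 2 b (b + 2) = 1 + ((ifib (Suc k))\<^sup>2 - ifib (Suc k) * ifib k - (ifib k)\<^sup>2)"
    by (simp add: mval_def k algebra_simps power2_eq_square)
  then show ?thesis unfolding ifib_Cassini k by simp
qed

text \<open>For a = 2 there are three choices of \<open>c\<close>, computed directly. For a \<ge> 3,
  F(a+b) + F(b) \<le> 3 F(a) F(b) yields z (3xy - z) \<ge> 2y^2 \<ge> x^2 + y^2, so the value is not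
  positive.\<close>

lemma mval_nonminimal:
  assumes "2 \<le> a" "a \<le> b" "b \<le> c" "c \<le> a + b" and pos: "0 < mval a b c"
  shows "a = 2 \<and> c = b + 2 \<and> even b"
proof (cases "a = 2")
  case True
  obtain k where b: "b = Suc (Suc k)" using assms by (metis add_2_eq_Suc le_Suc_ex le_trans)
  define p r where pr: "p = ifib (Suc k)" "r = ifib k"
  have "0 < p" "0 \<le> r" using fib_neq_0_nat[of "Suc k"] by (simp_all add: pr)
  then have nn: "0 < p * p" "0 \<le> p * r" "0 \<le> r * r" by simp_all
  consider "c = b" | "c = b + 1" | "c = b + 2" using True assms by linarith
  then show ?thesis
  proof cases
    case 1
    have "mval a b c = 1 - (p * p + 2 * (p * r) + r * r)"
      by (simp add: mval_def True 1 b pr algebra_simps power2_eq_square)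
    then show ?thesis using pos nn by linarith
  next
    case 2
    have "mval a b c = 1 - (p * p + 3 * (p * r) + r * r)"
      by (simp add: mval_def True 2 b pr algebra_simps power2_eq_square)
    then show ?thesis using pos nn by linarith
  next
    case 3
    then have "even b" using mval_2_add_2[of b] assms True by (cases "even b") auto
    then show ?thesis using True 3 by simp
  qed
next
  case False
  define k l where "k = a - 3" and "l = b - 2"
  have kl: "a = k + 3" "b = Suc (Suc l)" using False assms by (auto simp: k_def l_def)
  define x y z where xyz: "x = ifib a" "y = ifib b" "z = ifib c"
  have xy: "0 < x" "x \<le> y" "y \<le> z" using assms by (auto simp: xyz fib_mono fib_neq_0_nat)
  have "1 * fib b \<le> fib (Suc k) * fib b"
    using fib_neq_0_nat[of "Suc k"] by (intro mult_le_mono1) simp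
  moreover have "fib (a + b) = fib (Suc (Suc (Suc l))) * fib (Suc (Suc (Suc k))) + fib b * fib (Suc (Suc k))"
    using fib_add[of "Suc (Suc k)" b] by (simp add: kl eval_nat_numeral)
  ultimately have "fib (a + b) + fib b \<le> 3 * (fib a * fib b)"
    by (simp add: kl eval_nat_numeral algebra_simps)
  then have "int (fib (a + b) + fib b) \<le> int (3 * (fib a * fib b))" by (rule of_nat_mono)
  then have d0: "ifib (a + b) + y \<le> 3 * (x * y)" by (simp add: xyz)
  have "2 * (y * y) \<le> z * (3 * (x * y) - z)"
  \<comment> \<open>If c \<ge> b + 2, the factors z and 3xy - z are at least 2y and y; otherwise
    they are at least y and 2y.\<close>
  proof (cases "b + 2 \<le> c")
    case True
    then have "fib (b + 2) \<le> fib c" by (rule fib_mono)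
    then have "2 * y \<le> z" using fib_Suc_mono[of b] by (simp add: xyz)
    moreover have "ifib c \<le> ifib (a + b)" using assms by (simp add: fib_mono)
    ultimately have "(2 * y) * y \<le> z * (3 * (x * y) - z)"
      using xy d0 by (intro mult_mono) (auto simp: xyz)
    then show ?thesis by simp
  next
    case False
    define j where "j = a + b - 2"
    have j: "a + b = j + 2" using assms by (simp add: j_def)
    have "fib c \<le> fib (j + 1)" "fib b \<le> fib j" using \<open>a \<noteq> 2\<close> False assms j by (auto intro!: fib_mono)
    then have "2 * y \<le> 3 * (x * y) - z" using d0 by (simp add: j xyz)
    then have "y * (2 * y) \<le> z * (3 * (x * y) - z)" using xy by (intro mult_mono) auto
    then show ?thesis by simp
  qed
  moreover have "x * x \<le> y * y" using xy by (intro mult_mono) auto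
  moreover have "mval a b c = x * x + y * y - z * (3 * (x * y) - z)"
    by (simp add: mval_def xyz power2_eq_square algebra_simps)
  ultimately show ?thesis using pos by linarith
qed

text \<open>Since F(1) = F(2), index 1 is replaced by 2, so that all indices lie where F is strictly
  increasing.\<close>

lemma fib_index:
  assumes "0 < x" "x \<in> range fib"
  obtains a where "2 \<le> a" "x = fib a"
proof -
  obtain n where n: "x = fib n" using assms by auto
  consider "n = 0" | "n = 1" | "2 \<le> n" by linarith
  then show ?thesis using assms n that[of 2] that[of n] by cases auto
qed

lemma fib_le_iff: "2 \<le> a \<Longrightarrow> 2 \<le> b \<Longrightarrow> fib a \<le> fib b \<longleftrightarrow> a \<le> b"
  using fib_mono[of a b] fib_strict_mono[of b a] by linarith

lemma markoff_triple_fib_iff: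
  assumes "2 \<le> a" "2 \<le> b" "2 \<le> c"
  shows "markoff_triple m (fib a, fib b, fib c) \<longleftrightarrow> a \<le> b \<and> b \<le> c \<and> mval a b c = int m"
proof -
  have "(fib a)\<^sup>2 + (fib b)\<^sup>2 + (fib c)\<^sup>2 = 3 * fib a * fib b * fib c + m \<longleftrightarrow>
      int ((fib a)\<^sup>2 + (fib b)\<^sup>2 + (fib c)\<^sup>2) = int (3 * fib a * fib b * fib c + m)"
    by (rule of_nat_eq_iff[symmetric])
  also have "\<dots> \<longleftrightarrow> mval a b c = int m" by (auto simp: mval_def)
  finally show ?thesis
    using assms fib_pos[of a] by (simp add: markoff_triple_def fib_le_iff)
qed

lemma fibonacci_solutions_cases:
  assumes "t \<in> fibonacci_solutions m" "0 < m"
  obtains (nonminimal) b where "even b" "2 \<le> b" "t = (1, fib b, fib (b + 2))" "m = 2"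
  | (minimal) a b c where "2 \<le> a" "a \<le> b" "a + b < c" "t = (fib a, fib b, fib c)" "mval a b c = int m"
proof -
  obtain x y z where t: "t = (x, y, z)" and mt: "markoff_triple m (x, y, z)"
    and "{x, y, z} \<subseteq> range fib"
    using assms unfolding fibonacci_solutions_def by auto
  moreover have "0 < x" "0 < y" "0 < z" using mt by (auto simp: markoff_triple_def)
  ultimately obtain a b c where "2 \<le> a" "2 \<le> b" "2 \<le> c" and xyz: "x = fib a" "y = fib b" "z = fib c"
    by (metis fib_index insert_subset)
  then have abc: "2 \<le> a" "a \<le> b" "b \<le> c" "mval a b c = int m"
    using mt markoff_triple_fib_iff by auto
  show thesis
  proof (cases "c \<le> a + b")
    case True
    then have ev: "a = 2" "c = b + 2" "even b" using mval_nonminimal[of a b c] abc assms by auto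
    have "mval a b c = 2" using mval_2_add_2[of b] ev abc by simp
    then have "m = 2" using abc by simp
    then show thesis using nonminimal[of b] ev abc t xyz by simp
  next
    case False
    then show thesis using minimal[of a b c] abc t xyz by simp
  qed
qed

text \<open>A collision between different maxima is the pair (3,3,7), (2,3,6), whose value 21 is
  excluded here.\<close>

lemma mval_injective:
  assumes "2 \<le> a" "a \<le> b" "a + b < c" "2 \<le> a'" "a' \<le> b'" "a' + b' < c'"
    and "mval a b c = mval a' b' c'" and "mval a b c \<noteq> 21"
  shows "a = a' \<and> b = b' \<and> c = c'"
proof -
  have 21: "mval 2 3 6 = 21" by (simp add: mval_def eval_nat_numeral)
  consider "c' < c" | "c < c'" | "c = c'" by linarith
  then show ?thesis
  proof cases
    case 1
    show ?thesis using mval_eq_consecutive[OF assms(1-6) 1 assms(7)] assms 21 by auto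
  next
    case 2
    show ?thesis using mval_eq_consecutive[OF assms(4-6,1-3) 2 assms(7)[symmetric]] assms 21 by auto
  next
    case 3
    then show ?thesis using mval_inj_same_max[of a b c a' b'] assms by blast
  qed
qed

text \<open>Keeps the triples with c > a + b out of the family for m = 2: the value is 12 for c = 5,
  and at least 3^2 - 4 = 5 for larger \<open>c\<close>.\<close>

lemma mval_neq_2:
  assumes "2 \<le> a" "a \<le> b" "a + b < c"
  shows "mval a b c \<noteq> 2"
proof (cases "c = 5")
  case True
  then have "a = 2" "b = 2" using assms by auto
  then show ?thesis using True by (simp add: mval_def eval_nat_numeral)
next
  case False
  then have "fib 4 \<le> fib (c - 2)" using assms by (intro fib_mono) simp
  then have "3\<^sup>2 \<le> (ifib (c - 2))\<^sup>2" unfolding fib_small by (intro power_mono) auto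
  then show ?thesis using mval_lower[OF assms] by simp
qed

lemma minimal_fibonacci_solution:
  assumes "2 \<le> a" "a \<le> b" "a + b < c" "mval a b c = int m"
  shows "(fib a, fib b, fib c) \<in> fibonacci_solutions m"
    and "minimal_markoff_triple m (fib a, fib b, fib c)"
proof -
  have mt: "markoff_triple m (fib a, fib b, fib c)"
    using assms by (subst markoff_triple_fib_iff) auto
  then show "(fib a, fib b, fib c) \<in> fibonacci_solutions m"
    by (simp add: fibonacci_solutions_def)
  show "minimal_markoff_triple m (fib a, fib b, fib c)"
    using mt fib_ge_3_mult[of a b c] assms by (simp add: minimal_markoff_triple_def mult.assoc)
qed

section \<open>Uniqueness, the values 2 and 21, and the infinite family\<close>

lemma fibonacci_solutions_unique:
  assumes "0 < m" "m \<noteq> 2" "m \<noteq> 21" "t \<in> fibonacci_solutions m" "t' \<in> fibonacci_solutions m"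
  shows "t = t'"
proof -
  obtain a b c where t: "2 \<le> a" "a \<le> b" "a + b < c" "t = (fib a, fib b, fib c)" "mval a b c = int m"
    using fibonacci_solutions_cases[OF assms(4,1)] assms(2) by metis
  obtain a' b' c' where t': "2 \<le> a'" "a' \<le> b'" "a' + b' < c'" "t' = (fib a', fib b', fib c')"
    "mval a' b' c' = int m"
    using fibonacci_solutions_cases[OF assms(5,1)] assms(2) by metis
  have "a = a' \<and> b = b' \<and> c = c'"
    using t t' assms(3) by (intro mval_injective) auto
  then show ?thesis using t t' by simp
qed

lemma fibonacci_solutions_2: "fibonacci_solutions 2 = {(1, fib b, fib (b + 2)) | b. even b \<and> b \<ge> 2}"
proof (intro equalityI subsetI)
  fix t assume "t \<in> fibonacci_solutions 2"
  then show "t \<in> {(1, fib b, fib (b + 2)) | b. even b \<and> b \<ge> 2}"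
    by (rule fibonacci_solutions_cases) (use mval_neq_2 in auto)
next
  fix t assume "t \<in> {(1::nat, fib b, fib (b + 2)) | b. even b \<and> b \<ge> 2}"
  then obtain b where b: "t = (fib 2, fib b, fib (b + 2))" "even b" "2 \<le> b" by auto
  then have "markoff_triple 2 t" using mval_2_add_2[of b] by (simp only: b(1), subst markoff_triple_fib_iff) auto
  then show "t \<in> fibonacci_solutions 2" by (simp add: fibonacci_solutions_def b(1) rangeI del: fib_2 fib.simps)
qed

lemma fib_mval_21:
  shows "mval 2 3 6 = int 21" "mval 3 3 7 = int 21"
    and "(fib 2, fib 3, fib 6) = (1, 2, 8)" "(fib 3, fib 3, fib 7) = (2, 2, 13)"
  by (simp_all add: mval_def eval_nat_numeral)

lemma fibonacci_solutions_21: "fibonacci_solutions 21 = {(1, 2, 8), (2, 2, 13)}"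
proof (intro equalityI subsetI)
  fix t assume "t \<in> fibonacci_solutions 21"
  then show "t \<in> {(1, 2, 8), (2, 2, 13)}"
  proof (rule fibonacci_solutions_cases)
    fix a b c assume abc: "2 \<le> a" "a \<le> b" "a + b < c" "t = (fib a, fib b, fib c)" "mval a b c = int 21"
    have eq: "mval a b c = mval 2 3 6" using abc(5) fib_mval_21(1) by simp
    \<comment> \<open>The known solution (2,3,6) serves as reference: a smaller maximum is
      impossible, a larger one forces (3,3,7), and an equal one forces the same triple.\<close>
    consider "c < 6" | "6 < c" | "c = 6" by linarith
    then have "(a, b, c) = (2, 3, 6) \<or> (a, b, c) = (3, 3, 7)"
    proof cases
      case 1
      then show ?thesis using mval_eq_consecutive[OF _ _ _ abc(1-3) _ eq[symmetric]] by simp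
    next
      case 2
      then show ?thesis using mval_eq_consecutive[OF abc(1-3) _ _ _ _ eq] by simp
    next
      case 3
      then show ?thesis using mval_inj_same_max[of a b 6 2 3] abc(1-3) eq by simp
    qed
    then show ?thesis using abc(4) fib_mval_21(3,4) by auto
  qed auto
next
  fix t :: "nat \<times> nat \<times> nat" assume "t \<in> {(1, 2, 8), (2, 2, 13)}"
  then show "t \<in> fibonacci_solutions 21"
    using minimal_fibonacci_solution(1)[of 2 3 6 21] minimal_fibonacci_solution(1)[of 3 3 7 21]
    unfolding fib_mval_21 by auto
qed

lemma infinite_minimal_unique:
  "infinite {m::nat. m > 0 \<and> (\<exists>t. fibonacci_solutions m = {t} \<and> minimal_markoff_triple m t)}"
proof -
  \<comment> \<open>The witnesses are the values of the triples (1, 1, F(n+7)). Starting at F(7) =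
    13 makes them at least 132, clear of 2 and 21.\<close>
  define f where "f n = nat (mval 2 2 (n + 7))" for n
  have eq: "mval 2 2 (n + 7) = ifib (n + 7) * (ifib (n + 7) - 3) + 2" for n
    by (simp add: mval_def algebra_simps power2_eq_square)
  have gt: "21 < mval 2 2 (n + 7)" for n
  proof -
    have "fib 7 \<le> fib (n + 7)" by (intro fib_mono) simp
    then have "13 \<le> ifib (n + 7)" by (simp add: eval_nat_numeral)
    then have "13 * 10 \<le> ifib (n + 7) * (ifib (n + 7) - 3)" by (intro mult_mono) auto
    then show ?thesis unfolding eq by simp
  qed
  have f: "mval 2 2 (n + 7) = int (f n)" for n using gt[of n] by (simp add: f_def)
  have "inj f"
  proof (rule injI)
    fix n n' assume "f n = f n'"
    then have "mval 2 2 (n + 7) = mval 2 2 (n' + 7)" by (simp add: f)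
    then have "n + 7 = n' + 7" using mval_injective[of 2 2 "n + 7" 2 2 "n' + 7"] gt[of n] by simp
    then show "n = n'" by simp
  qed
  then have "infinite (range f)" by (simp add: finite_image_iff)
  moreover have "range f \<subseteq> {m. m > 0 \<and> (\<exists>t. fibonacci_solutions m = {t} \<and> minimal_markoff_triple m t)}"
  proof (rule image_subsetI, rule CollectI, intro conjI exI)
    fix n
    define t where "t = (fib 2, fib 2, fib (n + 7))"
    have large: "21 < f n" using gt[of n] f[of n] by linarith
    then show "0 < f n" by simp
    have t: "t \<in> fibonacci_solutions (f n)" unfolding t_def
      by (rule minimal_fibonacci_solution[OF _ _ _ f]) auto
    have "s = t" if "s \<in> fibonacci_solutions (f n)" for s
      using large by (intro fibonacci_solutions_unique[OF _ _ _ that t]) auto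
    then show "fibonacci_solutions (f n) = {t}" using t by blast
    show "minimal_markoff_triple (f n) t" unfolding t_def
      by (rule minimal_fibonacci_solution[OF _ _ _ f]) auto
  qed
  ultimately show ?thesis by (rule infinite_super[rotated])
qed

theorem theorem1p1:
  shows "(\<forall>m::nat. m > 0 \<and> m \<noteq> 2 \<and> m \<noteq> 21 \<longrightarrow>
            (\<exists>\<^sub>\<le>\<^sub>1 t. t \<in> fibonacci_solutions m))
       \<and> fibonacci_solutions 2 = {(1, fib b, fib (b + 2)) | b. even b \<and> b \<ge> 2}
       \<and> fibonacci_solutions 21 = {(1, 2, 8), (2, 2, 13)}
       \<and> (\<forall>t \<in> fibonacci_solutions 21. minimal_markoff_triple 21 t)
       \<and> infinite {m::nat. m > 0 \<and>
            (\<exists>t. fibonacci_solutions m = {t} \<and> minimal_markoff_triple m t)}"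
proof (intro conjI)
  show "\<forall>m::nat. m > 0 \<and> m \<noteq> 2 \<and> m \<noteq> 21 \<longrightarrow> (\<exists>\<^sub>\<le>\<^sub>1 t. t \<in> fibonacci_solutions m)"
    by (auto intro!: Uniq_I dest: fibonacci_solutions_unique)
  show "\<forall>t \<in> fibonacci_solutions 21. minimal_markoff_triple 21 t"
    using minimal_fibonacci_solution(2)[of 2 3 6 21] minimal_fibonacci_solution(2)[of 3 3 7 21]
    unfolding fibonacci_solutions_21 fib_mval_21 by auto
qed (fact fibonacci_solutions_2 fibonacci_solutions_21 infinite_minimal_unique)+

end
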